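(* Let $M\ge 1$ and let $S\in\mathbb{R}^{M\times M}$ be a constant skew-symmetric matrix, $S^{T}=-S$. Let $Q(t)=Q(t;Q(t_0))$ be the solution of the linear matrix differential equation $\dot Q = SQ$ with initial value $Q(t_0)$ an orthogonal matrix, $Q(t_0)^{T}Q(t_0)=I$. Let $dQ=dQ(t)$ denote the matrix of differential one-forms $(dq_{ij}(t))$, where each entry $q_{ij}(t)$ of $Q(t;Q(t_0))$ is regarded as a function of the initial value $Q(t_0)\in\mathbb{R}^{M\times M}$ and is differentiated at the given orthogonal initial value. Then $$dQ(t)\wedge S\,dQ(t) = \mathrm{const},$$ i.e. for all $X,Y\in\mathbb{R}^{M\times M}$ the number $(dQ(t)\wedge S\,dQ(t))(X,Y)$ does not depend on $t$.
   Context: For a smooth function $f:\mathbb{R}^{M\times M}\to\mathbb{R}$ and a fixed location $Z\in\mathbb{R}^{M\times M}$, the differential of $f$ at $Z$ is the linear function $df(X)=\lim_{\Delta t\to0}\frac{f(Z+\Delta t X)-f(Z)}{\Delta t}=\sum_{i,j}\frac{\partial f}{\partial z_{ij}}(Z)\,x_{ij}$ for $X=(x_{ij})\in\mathbb{R}^{M\times M}$. The wedge product of two differentials is $(df\wedge dg)(X,Y)=df(X)\,dg(Y)-df(Y)\,dg(X)$. For matrix functions $P=(p_{ij})$ and $Q=(q_{ij})$ with values in $\mathbb{R}^{M\times M}$, $dP=(dp_{ij})$ and $dQ=(dq_{ij})$ are matrices of one-forms, and $dP\wedge dQ=\sum_{i=1}^{M}\sum_{j=1}^{M}dp_{ij}\wedge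 dq_{ij}$. For a constant matrix $A$, $A\,dQ$ is the matrix of one-forms with entries $(A\,dQ)_{ij}=\sum_{l}A_{il}\,dq_{lj}$. The solution $Q(t;Q_0)$ of $\dot Q=SQ$, $Q(t_0)=Q_0$, defines the flow map $\mathbb{R}^{M\times M}\to\mathbb{R}^{M\times M}$, $Q_0\mapsto Q(t;Q_0)$. *)

theory Defs
  imports "HOL-Analysis.Analysis"
begin

type_synonym 'm sqmat = "real ^ 'm ^ 'm"
type_synonym 'm one_form = "'m sqmat \<Rightarrow> real"
type_synonym 'm two_form = "'m sqmat \<Rightarrow> 'm sqmat \<Rightarrow> real"

definition differential :: "('m::finite sqmat \<Rightarrow> real) \<Rightarrow> 'm sqmat \<Rightarrow> 'm one_form" where
  "differential f Z = frechet_derivative f (at Z)"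

lemma differential_limit:
  assumes "f differentiable (at Z)"
  shows "((\<lambda>h. (f (Z + h *\<^sub>R X) - f Z) / h) \<longlongrightarrow> differential f Z X) (at 0)"
proof -
  let ?D = "frechet_derivative f (at Z)"
  have D: "(f has_derivative ?D) (at Z)"
    using assms frechet_derivative_works by blast
  have "((\<lambda>h::real. Z + h *\<^sub>R X) has_derivative (\<lambda>h. h *\<^sub>R X)) (at 0)"
    by (auto intro!: derivative_eq_intros)
  then have "((\<lambda>h. f (Z + h *\<^sub>R X)) has_derivative (\<lambda>h. ?D (h *\<^sub>R X))) (at 0)"
    by (rule has_derivative_compose) (use D in simp)
  moreover have "(\<lambda>h. ?D (h *\<^sub>R X)) = (*) (?D X)"
    using linear_frechet_derivative[OF assms] by (auto simp: linear_cmul fun_eq_iff)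
  ultimately have "((\<lambda>h. f (Z + h *\<^sub>R X)) has_field_derivative ?D X) (at 0)"
    by (simp add: has_field_derivative_def)
  then show ?thesis
    by (simp add: DERIV_def differential_def)
qed

definition wedge :: "'m::finite one_form \<Rightarrow> 'm one_form \<Rightarrow> 'm two_form" where
  "wedge \<alpha> \<beta> = (\<lambda>X Y. \<alpha> X * \<beta> Y - \<alpha> Y * \<beta> X)"

definition matrix_differential ::
    "('m::finite sqmat \<Rightarrow> 'm sqmat) \<Rightarrow> 'm sqmat \<Rightarrow> 'm one_form ^ 'm ^ 'm" where
  "matrix_differential P Z = (\<chi> i j. differential (\<lambda>W. P W $ i $ j) Z)"

definition matrix_wedge ::
    "'m::finite one_form ^ 'm ^ 'm \<Rightarrow> 'm one_form ^ 'm ^ 'm \<Rightarrow> 'm two_form" where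
  "matrix_wedge dP dQ = (\<lambda>X Y. \<Sum>i\<in>UNIV. \<Sum>j\<in>UNIV. wedge (dP $ i $ j) (dQ $ i $ j) X Y)"

definition const_mult_forms ::
    "'m::finite sqmat \<Rightarrow> 'm one_form ^ 'm ^ 'm \<Rightarrow> 'm one_form ^ 'm ^ 'm" where
  "const_mult_forms A dQ = (\<chi> i j. (\<lambda>X. \<Sum>l\<in>UNIV. A $ i $ l * (dQ $ l $ j) X))"

text \<open>\<open>\<phi> t Q0\<close> is the value at time \<open>t\<close> of the solution of \<open>Q' = S Q\<close> with \<open>Q(t0) = Q0\<close>.
  Every square matrix is an admissible initial value, since the differentials are
  taken with respect to the initial value in the full matrix space.\<close>

definition is_flow ::
    "'m::finite sqmat \<Rightarrow> real \<Rightarrow> (real \<Rightarrow> 'm sqmat \<Rightarrow> 'm sqmat) \<Rightarrow> bool" where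
  "is_flow S t0 \<phi> \<longleftrightarrow>
     (\<forall>Q0. \<phi> t0 Q0 = Q0 \<and>
       (\<forall>t. ((\<lambda>s. \<phi> s Q0) has_vector_derivative S ** \<phi> t Q0) (at t)))"

end

theory Submission
  imports Defs
begin

text \<open>
  Left multiplication by a skew-symmetric \<open>S\<close> is skew-adjoint for the Frobenius inner product on
  matrices, so \<open>U \<bullet> V\<close> is constant in time whenever \<open>U\<close> and \<open>V\<close> both solve \<open>Q' = S Q\<close>
  (\<open>inner_skew_solutions_constant\<close>). This one conservation law drives the whole proof.

  Taking \<open>V = U\<close>, norms are conserved, hence a solution vanishing at one time vanishes always;
  applied to \<open>\<phi> t (a X + b Y) - a \<phi> t X - b \<phi> t Y\<close> this shows that each flow map \<open>\<phi> t\<close> is linear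
  (\<open>linear_skew_flow\<close>). A linear map is its own derivative, so \<open>dQ(t)\<close> evaluated
  at \<open>X\<close> is \<open>\<phi> t X\<close>, and the two-form evaluated at \<open>(X, Y)\<close> becomes
  \<open>\<phi> t X \<bullet> (S \<phi> t Y) - \<phi> t Y \<bullet> (S \<phi> t X)\<close>. As \<open>S\<close> is constant, \<open>S \<phi> t Y\<close> and \<open>S \<phi> t X\<close> are again
  solutions, and the conservation law applies to both terms.
\<close>

lemma inner_skew_mult:
  fixes S U V :: "real ^ 'm::finite ^ 'm"
  assumes "transpose S = - S"
  shows "(S ** U) \<bullet> V = - (U \<bullet> (S ** V))"
proof -
  have S: "S $ i $ l = - (S $ l $ i)" for i l
    using arg_cong[OF assms, of "\<lambda>A. A $ l $ i"] by (simp add: transpose_def)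
  have "(S ** U) \<bullet> V = (\<Sum>i\<in>UNIV. \<Sum>j\<in>UNIV. \<Sum>l\<in>UNIV. S $ i $ l * U $ l $ j * V $ i $ j)"
    by (simp add: inner_vec_def matrix_matrix_mult_def sum_distrib_right)
  also have "\<dots> = (\<Sum>i\<in>UNIV. \<Sum>l\<in>UNIV. \<Sum>j\<in>UNIV. S $ i $ l * U $ l $ j * V $ i $ j)"
    by (intro sum.cong refl sum.swap)
  also have "\<dots> = (\<Sum>l\<in>UNIV. \<Sum>i\<in>UNIV. \<Sum>j\<in>UNIV. S $ i $ l * U $ l $ j * V $ i $ j)"
    by (rule sum.swap)
  also have "\<dots> = (\<Sum>l\<in>UNIV. \<Sum>j\<in>UNIV. \<Sum>i\<in>UNIV. S $ i $ l * U $ l $ j * V $ i $ j)"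
    by (intro sum.cong refl sum.swap)
  also have "\<dots> = (\<Sum>l\<in>UNIV. \<Sum>j\<in>UNIV. \<Sum>i\<in>UNIV. - (U $ l $ j * (S $ l $ i * V $ i $ j)))"
    by (intro sum.cong refl) (subst S, simp)
  also have "\<dots> = - (U \<bullet> (S ** V))"
    by (simp add: inner_vec_def matrix_matrix_mult_def sum_distrib_left sum_negf)
  finally show ?thesis .
qed

lemma bounded_linear_matrix_mult_right:
  fixes S :: "real ^ 'm::finite ^ 'm"
  shows "bounded_linear (\<lambda>A :: real ^ 'm ^ 'm. S ** A)"
  unfolding linear_conv_bounded_linear[symmetric]
proof (rule linearI)
  show "S ** (A + B) = S ** A + S ** B" for A B :: "real ^ 'm ^ 'm"
    by (rule matrix_add_ldistrib)
  show "S ** (r *\<^sub>R A) = r *\<^sub>R (S ** A)" for r and A :: "real ^ 'm ^ 'm"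
    by (simp add: vec_eq_iff matrix_matrix_mult_def sum_distrib_left mult_ac)
qed

lemma inner_skew_solutions_constant:
  fixes S :: "real ^ 'm::finite ^ 'm" and U V :: "real \<Rightarrow> real ^ 'm ^ 'm"
  assumes "transpose S = - S"
    and U: "\<And>t. (U has_vector_derivative S ** U t) (at t)"
    and V: "\<And>t. (V has_vector_derivative S ** V t) (at t)"
  shows "U s \<bullet> V s = U t \<bullet> V t"
proof -
  have "((\<lambda>t. U t \<bullet> V t) has_real_derivative 0) (at t)" for t
    using bounded_bilinear.has_vector_derivative[OF bounded_bilinear_inner U V, of t]
    by (simp add: inner_skew_mult[OF assms(1)] has_real_derivative_iff_has_vector_derivative)
  then show ?thesis
    using DERIV_isconst_all by blast
qed

text \<open>Uniqueness of solutions: the norm is conserved, so it stays zero.\<close>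

lemma skew_solution_eq_0:
  fixes S :: "real ^ 'm::finite ^ 'm" and U :: "real \<Rightarrow> real ^ 'm ^ 'm"
  assumes "transpose S = - S"
    and "\<And>t. (U has_vector_derivative S ** U t) (at t)"
    and "U t0 = 0"
  shows "U t = 0"
  using inner_skew_solutions_constant[OF assms(1,2,2), of t t0] assms(3) by simp

lemma linear_skew_flow:
  fixes S :: "real ^ 'm::finite ^ 'm"
  assumes skew: "transpose S = - S" and flow: "is_flow S t0 \<phi>"
  shows "linear (\<phi> t)"
proof (rule linearI)
  interpret S: bounded_linear "\<lambda>A :: real ^ 'm ^ 'm. S ** A"
    by (rule bounded_linear_matrix_mult_right)
  have \<phi>0: "\<phi> t0 Z = Z" for Z
    using flow by (auto simp: is_flow_def)
  have \<phi>: "((\<lambda>s. \<phi> s Z) has_vector_derivative S ** \<phi> t Z) (at t)" for t Z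
    using flow by (auto simp: is_flow_def)
  fix X Y :: "real ^ 'm ^ 'm" and r :: real
  define U where "U s = \<phi> s (X + Y) - (\<phi> s X + \<phi> s Y)" for s
  have "(U has_vector_derivative S ** U s) (at s)" for s
    unfolding U_def S.add S.diff by (intro derivative_intros \<phi>)
  moreover have "U t0 = 0"
    by (simp add: U_def \<phi>0)
  ultimately have "U t = 0"
    by (rule skew_solution_eq_0[OF skew])
  then show "\<phi> t (X + Y) = \<phi> t X + \<phi> t Y"
    by (simp add: U_def)
  define V where "V s = \<phi> s (r *\<^sub>R X) - r *\<^sub>R \<phi> s X" for s
  have "(V has_vector_derivative S ** V s) (at s)" for s
    unfolding V_def S.scaleR S.diff
    by (intro has_vector_derivative_diff \<phi>
        bounded_linear.has_vector_derivative[OF bounded_linear_scaleR_right])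
  moreover have "V t0 = 0"
    by (simp add: V_def \<phi>0)
  ultimately have "V t = 0"
    by (rule skew_solution_eq_0[OF skew])
  then show "\<phi> t (r *\<^sub>R X) = r *\<^sub>R \<phi> t X"
    by (simp add: V_def)
qed

lemma matrix_differential_linear:
  assumes "linear P"
  shows "(matrix_differential P Z $ i $ j) X = P X $ i $ j"
proof -
  have "linear (\<lambda>W. P W $ i $ j)"
    using assms by (auto intro!: linearI simp: linear_add linear_cmul)
  then have "((\<lambda>W. P W $ i $ j) has_derivative (\<lambda>W. P W $ i $ j)) (at Z)"
    by (simp add: linear_imp_has_derivative)
  then show ?thesis
    by (simp add: matrix_differential_def differential_def frechet_derivative_at[symmetric])
qed

text \<open>The double sum over entries in the wedge product is the Frobenius inner product.\<close>

lemma matrix_wedge_linear: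
  assumes "linear P"
  shows "matrix_wedge (matrix_differential P Z) (const_mult_forms S (matrix_differential P Z)) X Y
    = P X \<bullet> (S ** P Y) - P Y \<bullet> (S ** P X)"
  by (simp add: matrix_wedge_def wedge_def const_mult_forms_def matrix_differential_linear[OF assms]
      inner_vec_def matrix_matrix_mult_def sum_subtractf)

theorem mainTheorem1:
  fixes S Q0 :: "real ^ 'm::finite ^ 'm"
    and t0 :: real
    and \<phi> :: "real \<Rightarrow> real ^ 'm ^ 'm \<Rightarrow> real ^ 'm ^ 'm"
  assumes "transpose S = - S"
    and "is_flow S t0 \<phi>"
    and "orthogonal_matrix Q0"
  shows "\<forall>X Y. \<exists>c. \<forall>t.
    matrix_wedge (matrix_differential (\<phi> t) Q0)
      (const_mult_forms S (matrix_differential (\<phi> t) Q0)) X Y = c"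
proof (intro allI)
  fix X Y :: "real ^ 'm ^ 'm"
  have \<phi>: "((\<lambda>s. \<phi> s Z) has_vector_derivative S ** \<phi> t Z) (at t)" for t Z
    using assms(2) by (auto simp: is_flow_def)
  have S\<phi>: "((\<lambda>s. S ** \<phi> s Z) has_vector_derivative S ** (S ** \<phi> t Z)) (at t)" for t Z
    by (rule bounded_linear.has_vector_derivative[OF bounded_linear_matrix_mult_right \<phi>])
  have const: "\<phi> t Z \<bullet> (S ** \<phi> t W) = \<phi> t0 Z \<bullet> (S ** \<phi> t0 W)" for t Z W
    by (rule inner_skew_solutions_constant[OF assms(1) \<phi> S\<phi>])
  show "\<exists>c. \<forall>t. matrix_wedge (matrix_differential (\<phi> t) Q0)
      (const_mult_forms S (matrix_differential (\<phi> t) Q0)) X Y = c"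
    unfolding matrix_wedge_linear[OF linear_skew_flow[OF assms(1,2)]] by (metis const)
qed

end
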